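(* Let $d\ge 1$, let $x_n,x\in D([0,\infty),\mathbb{R}^d)$ with $x_n\to x$ in the local Skorokhod $J_1$ topology, and let $\Phi_n,\Phi\in\mathcal{H}=C([0,\infty)\times\mathbb{R}^d,\mathbb{R})$ with $\Phi_n\to\Phi$ uniformly on compact subsets of $[0,\infty)\times\mathbb{R}^d$. Set $y_n(t):=\Phi_n(t,x_n(t))$, $y(t):=\Phi(t,x(t))$, $\tau_n:=\tau(x_n,\Phi_n)=\inf\{t\ge 0: y_n(t)\ge 0\}$ and $\tau:=\tau(x,\Phi)=\inf\{t\ge 0: y(t)\ge 0\}$. If $(x,\Phi)$ satisfies the non-tangency condition NT, then $\tau_n\to\tau$ in $[0,\infty]$.
   Context: $D([0,\infty),\mathbb{R}^d)$ is the space of càdlàg paths $[0,\infty)\to\mathbb{R}^d$. Local $J_1$ topology: the coarsest topology making all restriction maps $D([0,\infty),\mathbb{R}^d)\to D([0,T],\mathbb{R}^d)$, $T>0$, continuous, where $D([0,T],\mathbb{R}^d)$ carries the Skorokhod $J_1$ topology; so $x_n\to x$ means that for every $T>0$ there are increasing homeomorphisms $\lambda_n$ of $[0,T]$ with $\sup_{t\le T}|\lambda_n(t)-t|\to 0$ and $\sup_{t\le T}\|x_n(\lambda_n(t))-x(t)\|\to 0$. Convention: $\inf\varnothing=\infty$, $\sup\varnothing=-\infty$. Condition NT for $(x,\Phi)$, with $y(t)=\Phi(t,x(t))$ and $\tau=\inf\{t\ge0:y(t)\ge0\}$: one of the following holds. (i) (No exit) $\tau=\infty$ and for every $T>0$,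 $\sup_{0\le s\le T}y(s)<0$. (ii) (Genuine crossing) $\tau<\infty$, and (NT-) for all $T<\tau$, $\sup_{0\le s\le T}y(s)<0$, and (NT+) for all $\varepsilon>0$, $\sup_{s\in[\tau,\tau+\varepsilon]}y(s)>0$. *)

theory Defs
  imports "HOL-Analysis.Analysis"
begin

text \<open>
  Paths with index set \<open>I\<close> are extensional functions, i.e. \<open>undefined\<close> outside \<open>I\<close>; so the
  elements below are in bijection with the paths \<open>I \<rightarrow> 'a\<close>.  Where the one-sided
  neighbourhood within \<open>I\<close> is empty (the left one at the left end point of \<open>I\<close>, the right one at
  the right end point) the filter is \<open>bot\<close> and the corresponding condition is void.
\<close>

definition cadlag_paths :: "real set \<Rightarrow> (real \<Rightarrow> 'a::real_normed_vector) set" where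
  "cadlag_paths I = {x \<in> extensional I. \<forall>t\<in>I.
     (x \<longlongrightarrow> x t) (at t within I \<inter> {t<..}) \<and>
     (\<exists>l. (x \<longlongrightarrow> l) (at t within I \<inter> {..<t}))}"

definition time_changes :: "real \<Rightarrow> (real \<Rightarrow> real) set" where
  "time_changes T =
     {\<gamma>. strict_mono_on {0..T} \<gamma> \<and> (\<exists>\<mu>. homeomorphism {0..T} {0..T} \<gamma> \<mu>)}"

definition J1_cost :: "real \<Rightarrow> (real \<Rightarrow> real) \<Rightarrow> (real \<Rightarrow> 'a::real_normed_vector) \<Rightarrow> (real \<Rightarrow> 'a) \<Rightarrow> real"
  where "J1_cost T \<gamma> x y =
    max (SUP t\<in>{0..T}. \<bar>\<gamma> t - t\<bar>) (SUP t\<in>{0..T}. norm (x (\<gamma> t) - y t))"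

definition J1_dist :: "real \<Rightarrow> (real \<Rightarrow> 'a::real_normed_vector) \<Rightarrow> (real \<Rightarrow> 'a) \<Rightarrow> real" where
  "J1_dist T x y = (INF \<gamma>\<in>time_changes T. J1_cost T \<gamma> x y)"

text \<open>
  For \<open>T \<ge> 0\<close> and paths in \<open>cadlag_paths {0..T}\<close> the suprema in \<open>J1_cost\<close> are over bounded sets,
  and \<open>J1_dist T\<close> is a metric there: see \<open>bdd_path_diff\<close> and \<open>Metric_space_J1\<close> below.
\<close>

definition J1_topology :: "real \<Rightarrow> (real \<Rightarrow> 'a::real_normed_vector) topology" where
  "J1_topology T = Metric_space.mtopology (cadlag_paths {0..T}) (J1_dist T)"

definition local_J1_topology :: "(real \<Rightarrow> 'a::real_normed_vector) topology" where
  "local_J1_topology = topology_generated_by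
     {{x \<in> cadlag_paths {0..}. restrict x {0..T} \<in> U} | T U. T > 0 \<and> openin (J1_topology T) U}"

text \<open>
  Values of \<open>\<Phi>\<close> at negative times are irrelevant: they enter neither continuity on
  \<open>[0,\<infinity>) \<times> 'a\<close> nor anything below.
\<close>

definition H_space :: "(real \<times> 'a::real_normed_vector \<Rightarrow> real) set" where
  "H_space = {\<Phi>. continuous_on ({0..} \<times> UNIV) \<Phi>}"

text \<open>
  Infima and suprema are taken in \<open>ereal\<close>, where \<open>Inf {} = \<infinity>\<close> and \<open>Sup {} = -\<infinity>\<close>.
  The exit time lies in \<open>[0,\<infinity>]\<close>, whose topology is the subspace topology of \<open>ereal\<close>.
\<close>

definition exit_time :: "(real \<Rightarrow> 'a) \<Rightarrow> (real \<times> 'a \<Rightarrow> real) \<Rightarrow> ereal" where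
  "exit_time x \<Phi> = (INF t\<in>{t. t \<ge> 0 \<and> \<Phi> (t, x t) \<ge> 0}. ereal t)"

definition NT_no_exit :: "(real \<Rightarrow> 'a) \<Rightarrow> (real \<times> 'a \<Rightarrow> real) \<Rightarrow> bool" where
  "NT_no_exit x \<Phi> \<longleftrightarrow> exit_time x \<Phi> = \<infinity> \<and>
     (\<forall>T>0. (SUP s\<in>{0..T}. ereal (\<Phi> (s, x s))) < 0)"

definition NT_minus :: "(real \<Rightarrow> 'a) \<Rightarrow> (real \<times> 'a \<Rightarrow> real) \<Rightarrow> bool" where
  "NT_minus x \<Phi> \<longleftrightarrow>
     (\<forall>T::real. ereal T < exit_time x \<Phi> \<longrightarrow> (SUP s\<in>{0..T}. ereal (\<Phi> (s, x s))) < 0)"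

definition NT_plus :: "(real \<Rightarrow> 'a) \<Rightarrow> (real \<times> 'a \<Rightarrow> real) \<Rightarrow> bool" where
  "NT_plus x \<Phi> \<longleftrightarrow> (\<forall>\<epsilon>::real. \<epsilon> > 0 \<longrightarrow>
     (SUP s\<in>{s. exit_time x \<Phi> \<le> ereal s \<and> ereal s \<le> exit_time x \<Phi> + ereal \<epsilon>}.
        ereal (\<Phi> (s, x s))) > 0)"

definition NT :: "(real \<Rightarrow> 'a) \<Rightarrow> (real \<times> 'a \<Rightarrow> real) \<Rightarrow> bool" where
  "NT x \<Phi> \<longleftrightarrow> NT_no_exit x \<Phi> \<or>
     (exit_time x \<Phi> < \<infinity> \<and> NT_minus x \<Phi> \<and> NT_plus x \<Phi>)"


lemma cadlag_paths_bounded: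
  fixes x :: "real \<Rightarrow> 'a::real_normed_vector"
  assumes "x \<in> cadlag_paths {0..T}"
  shows "bounded (x ` {0..T})"
proof -
  have "\<exists>U. open U \<and> t \<in> U \<and> bounded (x ` (U \<inter> {0..T}))" if t: "t \<in> {0..T}" for t
  proof -
    have r: "(x \<longlongrightarrow> x t) (at t within {0..T} \<inter> {t<..})"
      and "\<exists>l. (x \<longlongrightarrow> l) (at t within {0..T} \<inter> {..<t})"
      using assms t unfolding cadlag_paths_def by auto
    then obtain l where l: "(x \<longlongrightarrow> l) (at t within {0..T} \<inter> {..<t})" by blast
    have "eventually (\<lambda>s. dist (x s) (x t) < 1) (at t within {0..T} \<inter> {t<..})"
      using tendstoD[OF r, of 1] by simp
    then obtain U where U: "open U" "t \<in> U"
      "\<And>s. s \<in> U \<Longrightarrow> s \<noteq> t \<Longrightarrow> s \<in> {0..T} \<inter> {t<..} \<Longrightarrow> dist (x s) (x t) < 1"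
      unfolding eventually_at_topological by metis
    have "eventually (\<lambda>s. dist (x s) l < 1) (at t within {0..T} \<inter> {..<t})"
      using tendstoD[OF l, of 1] by simp
    then obtain V where V: "open V" "t \<in> V"
      "\<And>s. s \<in> V \<Longrightarrow> s \<noteq> t \<Longrightarrow> s \<in> {0..T} \<inter> {..<t} \<Longrightarrow> dist (x s) l < 1"
      unfolding eventually_at_topological by metis
    have "x ` ((U \<inter> V) \<inter> {0..T}) \<subseteq> ball (x t) 1 \<union> ball l 1"
    proof
      fix z assume "z \<in> x ` ((U \<inter> V) \<inter> {0..T})"
      then obtain s where s: "z = x s" "s \<in> U" "s \<in> V" "s \<in> {0..T}" by auto
      consider "s = t" | "s < t" | "s > t" by linarith
      then show "z \<in> ball (x t) 1 \<union> ball l 1"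
        by cases (use s U(3)[of s] V(3)[of s] in \<open>auto simp: dist_commute\<close>)
    qed
    then have "bounded (x ` ((U \<inter> V) \<inter> {0..T}))"
      by (rule bounded_subset[rotated]) auto
    then show ?thesis using U V by (intro exI[of _ "U \<inter> V"]) auto
  qed
  then obtain U where U: "\<And>t. t \<in> {0..T} \<Longrightarrow> open (U t) \<and> t \<in> U t \<and> bounded (x ` (U t \<inter> {0..T}))"
    by metis
  have "compact {0..T}" by simp
  then obtain C where C: "C \<subseteq> {0..T}" "finite C" "{0..T} \<subseteq> (\<Union>t\<in>C. U t)"
    by (rule compactE_image[of "{0..T}" "{0..T}" U]) (use U in auto)
  have "x ` {0..T} \<subseteq> (\<Union>t\<in>C. x ` (U t \<inter> {0..T}))" using C(3) by blast
  moreover have "bounded (\<Union>t\<in>C. x ` (U t \<inter> {0..T}))"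
    using C U by (intro bounded_UN) auto
  ultimately show ?thesis by (rule bounded_subset[rotated])
qed

lemma time_changes_mem: "\<gamma> \<in> time_changes T \<Longrightarrow> t \<in> {0..T} \<Longrightarrow> \<gamma> t \<in> {0..T}"
  unfolding time_changes_def homeomorphism_def by blast

lemma time_changes_id: "(\<lambda>t. t) \<in> time_changes T"
  unfolding time_changes_def using homeomorphism_ident[of "{0..T}"]
  by (intro CollectI conjI strict_mono_onI exI) auto

lemma time_changes_compose:
  assumes "\<gamma> \<in> time_changes T" "\<mu> \<in> time_changes T"
  shows "\<gamma> \<circ> \<mu> \<in> time_changes T"
proof -
  obtain l m where "homeomorphism {0..T} {0..T} \<gamma> l" "homeomorphism {0..T} {0..T} \<mu> m"
    using assms unfolding time_changes_def by auto
  then have "homeomorphism {0..T} {0..T} (\<gamma> \<circ> \<mu>) (m \<circ> l)"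
    by (intro homeomorphism_compose) auto
  moreover have "strict_mono_on {0..T} (\<gamma> \<circ> \<mu>)"
    using assms time_changes_mem[OF assms(2)]
    unfolding time_changes_def strict_mono_on_def by auto
  ultimately show ?thesis unfolding time_changes_def by blast
qed

lemma time_changes_inverse:
  assumes "\<gamma> \<in> time_changes T"
  obtains \<mu> where "\<mu> \<in> time_changes T"
    "\<And>t. t \<in> {0..T} \<Longrightarrow> \<gamma> (\<mu> t) = t" "\<And>t. t \<in> {0..T} \<Longrightarrow> \<mu> (\<gamma> t) = t"
proof -
  obtain \<mu> where h: "homeomorphism {0..T} {0..T} \<gamma> \<mu>" and m: "strict_mono_on {0..T} \<gamma>"
    using assms unfolding time_changes_def by auto
  have inv: "\<gamma> (\<mu> t) = t" "\<mu> (\<gamma> t) = t" "\<mu> t \<in> {0..T}" if "t \<in> {0..T}" for t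
    using h that unfolding homeomorphism_def by auto
  have "strict_mono_on {0..T} \<mu>"
  proof (rule strict_mono_onI)
    fix r s assume rs: "r \<in> {0..T}" "s \<in> {0..T}" "r < s"
    show "\<mu> r < \<mu> s"
    proof (rule ccontr)
      assume "\<not> \<mu> r < \<mu> s"
      then have "\<gamma> (\<mu> s) \<le> \<gamma> (\<mu> r)"
        using strict_mono_onD[OF m inv(3)[OF rs(2)] inv(3)[OF rs(1)]] by fastforce
      then show False using inv rs by simp
    qed
  qed
  then have "\<mu> \<in> time_changes T"
    using h homeomorphism_sym[of "{0..T}" "{0..T}" \<gamma> \<mu>] unfolding time_changes_def by blast
  then show thesis using inv that by blast
qed

lemma time_changes_end:
  assumes "\<gamma> \<in> time_changes T" "0 \<le> T"
  shows "\<gamma> T = T"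
proof -
  obtain \<mu> where mu: "\<mu> \<in> time_changes T" "\<And>t. t \<in> {0..T} \<Longrightarrow> \<gamma> (\<mu> t) = t"
    using time_changes_inverse[OF assms(1)] by metis
  have "\<mu> T \<le> T" using time_changes_mem[OF mu(1), of T] assms by auto
  then have "\<gamma> (\<mu> T) \<le> \<gamma> T"
    using assms time_changes_mem[OF mu(1), of T] unfolding time_changes_def strict_mono_on_def
    by (cases "\<mu> T = T") (auto simp: less_le)
  then show ?thesis using mu(2)[of T] time_changes_mem[OF assms(1), of T] assms by auto
qed

lemma bdd_time_change:
  assumes "\<gamma> \<in> time_changes T"
  shows "bdd_above ((\<lambda>t. \<bar>\<gamma> t - t\<bar>) ` {0..T})"
proof (rule bdd_aboveI2)
  fix t assume t: "t \<in> {0..T}"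
  show "\<bar>\<gamma> t - t\<bar> \<le> T" using time_changes_mem[OF assms t] t by auto
qed

lemma bdd_path_diff:
  assumes "\<gamma> \<in> time_changes T" "x \<in> cadlag_paths {0..T}" "y \<in> cadlag_paths {0..T}"
  shows "bdd_above ((\<lambda>t. norm (x (\<gamma> t) - y t)) ` {0..T})"
proof -
  obtain A B where AB: "\<And>t. t \<in> {0..T} \<Longrightarrow> norm (x t) \<le> A" "\<And>t. t \<in> {0..T} \<Longrightarrow> norm (y t) \<le> B"
    using cadlag_paths_bounded[OF assms(2)] cadlag_paths_bounded[OF assms(3)]
    unfolding bounded_iff by blast
  show ?thesis
  proof (rule bdd_aboveI2)
    fix t assume t: "t \<in> {0..T}"
    then show "norm (x (\<gamma> t) - y t) \<le> A + B"
      using AB(1)[OF time_changes_mem[OF assms(1) t]] AB(2)[OF t]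
        norm_triangle_ineq4[of "x (\<gamma> t)" "y t"] by linarith
  qed
qed

lemma J1_cost_nonneg:
  assumes "\<gamma> \<in> time_changes T" "0 \<le> T"
  shows "0 \<le> J1_cost T \<gamma> x y"
proof -
  have "\<bar>\<gamma> 0 - 0\<bar> \<le> (SUP t\<in>{0..T}. \<bar>\<gamma> t - t\<bar>)"
    by (rule cSUP_upper[OF _ bdd_time_change[OF assms(1)]]) (use assms in auto)
  then show ?thesis unfolding J1_cost_def by linarith
qed

lemma bdd_J1_cost:
  assumes "0 \<le> T"
  shows "bdd_below ((\<lambda>\<gamma>. J1_cost T \<gamma> x y) ` time_changes T)"
  by (rule bdd_belowI2[where m=0]) (rule J1_cost_nonneg[OF _ assms])

lemma J1_dist_le:
  assumes "0 \<le> T" "\<gamma> \<in> time_changes T"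
    "\<And>t. t \<in> {0..T} \<Longrightarrow> \<bar>\<gamma> t - t\<bar> \<le> e" "\<And>t. t \<in> {0..T} \<Longrightarrow> norm (x (\<gamma> t) - y t) \<le> e"
  shows "J1_dist T x y \<le> e"
proof -
  have "J1_dist T x y \<le> J1_cost T \<gamma> x y"
    unfolding J1_dist_def by (rule cINF_lower[OF bdd_J1_cost[OF assms(1)] assms(2)])
  also have "\<dots> \<le> e"
    unfolding J1_cost_def using assms by (intro max.boundedI cSUP_least) auto
  finally show ?thesis .
qed

lemma J1_dist_lessE:
  assumes "0 \<le> T" "x \<in> cadlag_paths {0..T}" "y \<in> cadlag_paths {0..T}" "J1_dist T x y < e"
  obtains \<gamma> where "\<gamma> \<in> time_changes T" "\<And>t. t \<in> {0..T} \<Longrightarrow> \<bar>\<gamma> t - t\<bar> < e"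
    "\<And>t. t \<in> {0..T} \<Longrightarrow> norm (x (\<gamma> t) - y t) < e"
proof -
  have "time_changes T \<noteq> {}" using time_changes_id by blast
  then obtain \<gamma> where l: "\<gamma> \<in> time_changes T" "J1_cost T \<gamma> x y < e"
    using assms(4) cINF_less_iff[OF _ bdd_J1_cost[OF assms(1)], of x y e]
    unfolding J1_dist_def by auto
  have "\<bar>\<gamma> t - t\<bar> < e" if "t \<in> {0..T}" for t
    using cSUP_upper[OF that bdd_time_change[OF l(1)]] l(2) unfolding J1_cost_def by linarith
  moreover have "norm (x (\<gamma> t) - y t) < e" if "t \<in> {0..T}" for t
    using cSUP_upper[OF that bdd_path_diff[OF l(1) assms(2,3)]] l(2)
    unfolding J1_cost_def by linarith
  ultimately show thesis using l that by blast
qed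

lemma J1_dist_commute: "J1_dist T x y = J1_dist T y x"
proof -
  have sub: "(\<lambda>\<gamma>. J1_cost T \<gamma> x y) ` time_changes T \<subseteq> (\<lambda>\<gamma>. J1_cost T \<gamma> y x) ` time_changes T"
    for x y :: "real \<Rightarrow> 'a"
  proof clarify
    fix \<gamma> assume l: "\<gamma> \<in> time_changes T"
    obtain \<mu> where mu: "\<mu> \<in> time_changes T"
      "\<And>t. t \<in> {0..T} \<Longrightarrow> \<gamma> (\<mu> t) = t" "\<And>t. t \<in> {0..T} \<Longrightarrow> \<mu> (\<gamma> t) = t"
      using time_changes_inverse[OF l] by metis
    have im: "\<mu> ` {0..T} = {0..T}"
    proof (intro subset_antisym subsetI)
      show "t \<in> {0..T}" if "t \<in> \<mu> ` {0..T}" for t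
        using that time_changes_mem[OF mu(1)] by blast
      show "t \<in> \<mu> ` {0..T}" if "t \<in> {0..T}" for t
        using mu(3)[OF that] time_changes_mem[OF l that] by (metis image_eqI)
    qed
    have "(\<lambda>t. \<bar>\<gamma> t - t\<bar>) ` {0..T} = (\<lambda>t. \<bar>\<gamma> t - t\<bar>) ` \<mu> ` {0..T}" by (simp only: im)
    also have "\<dots> = (\<lambda>t. \<bar>\<mu> t - t\<bar>) ` {0..T}"
      unfolding image_image by (rule image_cong) (use mu in \<open>auto simp: abs_minus_commute\<close>)
    finally have 1: "(\<lambda>t. \<bar>\<gamma> t - t\<bar>) ` {0..T} = (\<lambda>t. \<bar>\<mu> t - t\<bar>) ` {0..T}" .
    have "(\<lambda>t. norm (x (\<gamma> t) - y t)) ` {0..T} = (\<lambda>t. norm (x (\<gamma> t) - y t)) ` \<mu> ` {0..T}"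
      by (simp only: im)
    also have "\<dots> = (\<lambda>t. norm (y (\<mu> t) - x t)) ` {0..T}"
      unfolding image_image by (rule image_cong) (use mu in \<open>auto simp: norm_minus_commute\<close>)
    finally have "J1_cost T \<gamma> x y = J1_cost T \<mu> y x" unfolding J1_cost_def using 1 by simp
    then show "J1_cost T \<gamma> x y \<in> (\<lambda>\<gamma>. J1_cost T \<gamma> y x) ` time_changes T" using mu by blast
  qed
  show ?thesis unfolding J1_dist_def using sub[of x y] sub[of y x] by (simp add: subset_antisym)
qed

lemma J1_dist_triangle:
  assumes "0 \<le> T" "x \<in> cadlag_paths {0..T}" "y \<in> cadlag_paths {0..T}" "z \<in> cadlag_paths {0..T}"
  shows "J1_dist T x z \<le> J1_dist T x y + J1_dist T y z"
proof (rule field_le_epsilon)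
  fix e :: real assume "0 < e"
  then have "J1_dist T x y < J1_dist T x y + e/2" "J1_dist T y z < J1_dist T y z + e/2" by auto
  then obtain \<gamma> \<mu> where l: "\<gamma> \<in> time_changes T"
      "\<And>t. t \<in> {0..T} \<Longrightarrow> \<bar>\<gamma> t - t\<bar> < J1_dist T x y + e/2"
      "\<And>t. t \<in> {0..T} \<Longrightarrow> norm (x (\<gamma> t) - y t) < J1_dist T x y + e/2"
    and m: "\<mu> \<in> time_changes T" "\<And>t. t \<in> {0..T} \<Longrightarrow> \<bar>\<mu> t - t\<bar> < J1_dist T y z + e/2"
      "\<And>t. t \<in> {0..T} \<Longrightarrow> norm (y (\<mu> t) - z t) < J1_dist T y z + e/2"
    using J1_dist_lessE[OF assms(1,2,3)] J1_dist_lessE[OF assms(1,3,4)] by metis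
  show "J1_dist T x z \<le> J1_dist T x y + J1_dist T y z + e"
  proof (rule J1_dist_le[OF assms(1) time_changes_compose[OF l(1) m(1)]])
    fix t assume t: "t \<in> {0..T}"
    note t' = time_changes_mem[OF m(1) t]
    show "\<bar>(\<gamma> \<circ> \<mu>) t - t\<bar> \<le> J1_dist T x y + J1_dist T y z + e"
      using l(2)[OF t'] m(2)[OF t] by simp
    show "norm (x ((\<gamma> \<circ> \<mu>) t) - z t) \<le> J1_dist T x y + J1_dist T y z + e"
      using l(3)[OF t'] m(3)[OF t] norm_triangle_ineq[of "x (\<gamma> (\<mu> t)) - y (\<mu> t)" "y (\<mu> t) - z t"]
      by simp
  qed
qed

lemma J1_dist_eq_0:
  fixes x y :: "real \<Rightarrow> 'a::real_normed_vector"
  assumes T: "0 \<le> T" and x: "x \<in> cadlag_paths {0..T}" and y: "y \<in> cadlag_paths {0..T}"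
    and d0: "J1_dist T x y = 0"
  shows "x = y"
proof -
  have right: "\<exists>d>0. \<forall>s\<in>{0..T}. t < s \<and> s < t + d \<longrightarrow> dist (z s) (z t) < e"
    if "z \<in> cadlag_paths {0..T}" "t \<in> {0..T}" "e > 0" for z :: "real \<Rightarrow> 'a" and t e
  proof -
    have "(z \<longlongrightarrow> z t) (at t within {0..T} \<inter> {t<..})"
      using that unfolding cadlag_paths_def by auto
    then obtain d where "d > 0" and
      d: "\<forall>s\<in>{0..T} \<inter> {t<..}. 0 < dist s t \<and> dist s t < d \<longrightarrow> dist (z s) (z t) < e"
      using \<open>e > 0\<close> unfolding Lim_within by blast
    show ?thesis
    proof (intro exI[of _ d] conjI ballI impI)
      fix s assume "s \<in> {0..T}" "t < s \<and> s < t + d"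
      then show "dist (z s) (z t) < e" by (intro d[rule_format]) (auto simp: dist_real_def)
    qed (fact \<open>d > 0\<close>)
  qed
  have split: "y t = x t \<or> y t = l"
    if t: "t \<in> {0..T}" and l: "(x \<longlongrightarrow> l) (at t within {0..T} \<inter> {..<t})" for t l
  proof (rule ccontr)
    assume *: "\<not> (y t = x t \<or> y t = l)"
    define e where "e = min (dist (y t) (x t)) (dist (y t) l) / 2"
    have e: "e > 0" "2 * e \<le> dist (y t) (x t)" "2 * e \<le> dist (y t) l"
      using * by (auto simp: e_def)
    obtain d where d: "d > 0" "\<forall>s\<in>{0..T}. t < s \<and> s < t + d \<longrightarrow> dist (x s) (x t) < e"
      using right[OF x t e(1)] by blast
    obtain d' where d': "d' > 0"
      "\<forall>s\<in>{0..T} \<inter> {..<t}. 0 < dist s t \<and> dist s t < d' \<longrightarrow> dist (x s) l < e"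
      using l e(1) unfolding Lim_within by blast
    have "J1_dist T x y < min e (min d d')" using d0 e d d' by simp
    then obtain \<gamma> where lam: "\<gamma> \<in> time_changes T"
      "\<bar>\<gamma> t - t\<bar> < min e (min d d')" "norm (x (\<gamma> t) - y t) < min e (min d d')"
      using J1_dist_lessE[OF T x y] t by metis
    have mem: "\<gamma> t \<in> {0..T}" using time_changes_mem[OF lam(1) t] .
    have close: "dist (x (\<gamma> t)) (y t) < e" using lam(3) by (simp add: dist_norm)
    consider "\<gamma> t = t" | "\<gamma> t < t" | "\<gamma> t > t" by linarith
    then show False
    proof cases
      case 1
      then show ?thesis using close e by (simp add: dist_commute)
    next
      case 2
      then have "dist (x (\<gamma> t)) l < e" using mem lam(2) by (intro d'(2)[rule_format]) (auto simp: dist_real_def)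
      then show ?thesis using close e dist_triangle3[of "y t" l "x (\<gamma> t)"] by linarith
    next
      case 3
      then have "dist (x (\<gamma> t)) (x t) < e" using d(2) mem lam(2) by auto
      then show ?thesis using close e dist_triangle3[of "y t" "x t" "x (\<gamma> t)"] by linarith
    qed
  qed
  have "x t = y t" if t: "t \<in> {0..T}" for t
  proof (cases "t = T")
    case True
    have "norm (x T - y T) \<le> e" if "e > 0" for e
    proof -
      have "J1_dist T x y < e" using d0 that by simp
      then obtain \<gamma> where "\<gamma> \<in> time_changes T" "norm (x (\<gamma> T) - y T) < e"
        using J1_dist_lessE[OF T x y] T by (metis atLeastAtMost_iff order_refl)
      then show ?thesis using time_changes_end[OF _ T] by fastforce
    qed
    then have "norm (x T - y T) \<le> 0" by (rule field_le_epsilon) simp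
    then show ?thesis using True by simp
  next
    case False
    have "dist (x t) (y t) \<le> e" if "e > 0" for e
    proof -
      have e2: "e/2 > 0" using that by simp
      obtain d where d: "d > 0" "\<forall>s\<in>{0..T}. t < s \<and> s < t + d \<longrightarrow> dist (x s) (x t) < e/2"
        using right[OF x t e2] by blast
      obtain d' where d': "d' > 0" "\<forall>s\<in>{0..T}. t < s \<and> s < t + d' \<longrightarrow> dist (y s) (y t) < e/2"
        using right[OF y t e2] by blast
      define m where "m = min T (min (t + d) (t + d'))"
      have m: "t < m" "m \<le> T" "m \<le> t + d" "m \<le> t + d'"
        using t False d(1) d'(1) by (auto simp: m_def)
      define s where "s = (t + m) / 2"
      have ts: "t < s" "s < m" using m(1) by (auto simp: s_def)
      have s: "t < s" "s < t + d" "s < t + d'" "s \<in> {0..T}"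
        using ts m t by auto
      obtain l where l: "(x \<longlongrightarrow> l) (at s within {0..T} \<inter> {..<s})"
        using x s(4) unfolding cadlag_paths_def by blast
      have ev: "eventually (\<lambda>u. dist (x u) (x t) \<le> e/2) (at s within {0..T} \<inter> {..<s})"
        unfolding eventually_at
      proof (intro exI[of _ "s - t"] conjI ballI impI)
        fix u assume u: "u \<in> {0..T} \<inter> {..<s}" "u \<noteq> s \<and> dist u s < s - t"
        then have "t < u" "u < t + d" using s by (auto simp: dist_real_def)
        then show "dist (x u) (x t) \<le> e/2" using u d by (auto intro: less_imp_le)
      qed (use s in auto)
      have "s islimpt {0..T} \<inter> {..<s}"
      proof (rule islimptI)
        fix U assume "s \<in> U" "open U"
        then obtain r where r: "r > 0" "ball s r \<subseteq> U" by (meson open_contains_ball)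
        define h where "h = min r (s - t)"
        have h: "h > 0" "h \<le> r" "h \<le> s - t" using r s(1) by (auto simp: h_def)
        define u where "u = s - h / 2"
        have u: "u < s" "t < u" "s - u < r" using h r(1) s(1) by (auto simp: u_def)
        have "u \<in> {0..T} \<inter> {..<s}" "u \<in> ball s r" "u \<noteq> s"
          using u s(4) t by (auto simp: dist_real_def)
        then show "\<exists>u\<in>{0..T} \<inter> {..<s}. u \<in> U \<and> u \<noteq> s" using r by blast
      qed
      then have "at s within {0..T} \<inter> {..<s} \<noteq> bot" by (simp add: trivial_limit_within)
      then have "dist l (x t) \<le> e/2"
        using tendsto_upperbound[OF tendsto_dist[OF l tendsto_const] ev] by blast
      moreover have "dist (x s) (x t) \<le> e/2" using d s by (auto intro: less_imp_le)
      ultimately have "dist (y s) (x t) \<le> e/2" using split[OF s(4) l] by metis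
      moreover have "dist (y s) (y t) < e/2" using d' s by auto
      ultimately show ?thesis using dist_triangle3[of "x t" "y t" "y s"] by linarith
    qed
    then have "dist (x t) (y t) \<le> 0" by (rule field_le_epsilon) simp
    then show ?thesis by simp
  qed
  moreover have "x \<in> extensional {0..T}" "y \<in> extensional {0..T}"
    using x y unfolding cadlag_paths_def by auto
  ultimately show ?thesis by (intro extensionalityI[of x "{0..T}" y]) auto
qed

lemma Metric_space_J1:
  assumes "0 \<le> T"
  shows "Metric_space (cadlag_paths {0..T}) (J1_dist T)"
proof
  show nn: "0 \<le> J1_dist T x y" for x y :: "real \<Rightarrow> 'a"
    unfolding J1_dist_def using J1_cost_nonneg[OF _ assms] time_changes_id[of T]
    by (intro cINF_greatest) blast+
  show "J1_dist T x y = J1_dist T y x" for x y :: "real \<Rightarrow> 'a" by (rule J1_dist_commute)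
  show "J1_dist T x y = 0 \<longleftrightarrow> x = y"
    if "x \<in> cadlag_paths {0..T}" "y \<in> cadlag_paths {0..T}" for x y :: "real \<Rightarrow> 'a"
  proof
    assume "x = y"
    then have "J1_dist T x y \<le> 0" by (intro J1_dist_le[OF assms time_changes_id]) auto
    then show "J1_dist T x y = 0" using nn[of x y] by linarith
  qed (use J1_dist_eq_0[OF assms that] in auto)
qed (rule J1_dist_triangle[OF assms])

lemma cadlag_paths_restrict:
  assumes "x \<in> cadlag_paths I" "J \<subseteq> I"
  shows "restrict x J \<in> cadlag_paths J"
proof -
  have tr: "(restrict x J \<longlongrightarrow> l) (at t within J \<inter> S)" if "(x \<longlongrightarrow> l) (at t within I \<inter> S)" for l t S
  proof -
    have "(x \<longlongrightarrow> l) (at t within J \<inter> S)"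
      by (rule tendsto_within_subset[OF that]) (use assms in auto)
    then show ?thesis
      by (rule Lim_transform_eventually) (auto simp: eventually_at_filter)
  qed
  show ?thesis
    unfolding cadlag_paths_def
  proof (intro CollectI conjI ballI)
    fix t assume t: "t \<in> J"
    then have "(x \<longlongrightarrow> x t) (at t within I \<inter> {t<..})" "\<exists>l. (x \<longlongrightarrow> l) (at t within I \<inter> {..<t})"
      using assms unfolding cadlag_paths_def by auto
    then show "(restrict x J \<longlongrightarrow> restrict x J t) (at t within J \<inter> {t<..})"
      "\<exists>l. (restrict x J \<longlongrightarrow> l) (at t within J \<inter> {..<t})"
      using tr t by (auto intro: exI)
  qed auto
qed

lemma topspace_J1: "0 \<le> T \<Longrightarrow> topspace (J1_topology T) = cadlag_paths {0..T}"
  unfolding J1_topology_def by (rule Metric_space.topspace_mtopology[OF Metric_space_J1])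

lemma topspace_local_J1:
  "topspace (local_J1_topology :: (real \<Rightarrow> 'a::real_normed_vector) topology) = cadlag_paths {0..}"
proof -
  have "(cadlag_paths {0..} :: (real \<Rightarrow> 'a) set) \<in> {{x \<in> cadlag_paths {0..}. restrict x {0..T} \<in> U} | T U.
      T > 0 \<and> openin (J1_topology T) U}"
  proof (intro CollectI exI conjI)
    have "restrict x {0..1} \<in> cadlag_paths {0..1}" if "x \<in> cadlag_paths {0..}" for x :: "real \<Rightarrow> 'a"
      by (rule cadlag_paths_restrict[OF that]) auto
    then show "cadlag_paths {0..} =
        {x \<in> cadlag_paths {0..}. restrict x {0..1} \<in> (cadlag_paths {0..1} :: (real \<Rightarrow> 'a) set)}"
      by blast
    show "openin (J1_topology 1) (cadlag_paths {0..1} :: (real \<Rightarrow> 'a) set)"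
      using openin_topspace[of "J1_topology 1 :: (real \<Rightarrow> 'a) topology"] by (simp add: topspace_J1)
  qed simp
  then show ?thesis unfolding local_J1_topology_def topology_generated_by_topspace by blast
qed

lemma limitin_topology_generated_by:
  "limitin (topology_generated_by \<S>) f l F \<longleftrightarrow>
     l \<in> \<Union>\<S> \<and> (\<forall>U\<in>\<S>. l \<in> U \<longrightarrow> eventually (\<lambda>n. f n \<in> U) F)"
proof
  assume "limitin (topology_generated_by \<S>) f l F"
  then show "l \<in> \<Union>\<S> \<and> (\<forall>U\<in>\<S>. l \<in> U \<longrightarrow> eventually (\<lambda>n. f n \<in> U) F)"
    unfolding limitin_def topology_generated_by_topspace by (blast intro: topology_generated_by_Basis)
next
  assume *: "l \<in> \<Union>\<S> \<and> (\<forall>U\<in>\<S>. l \<in> U \<longrightarrow> eventually (\<lambda>n. f n \<in> U) F)"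
  have "l \<in> U \<longrightarrow> eventually (\<lambda>n. f n \<in> U) F" if "generate_topology_on \<S> U" for U
    using that
  proof induction
    case (Int a b)
    then show ?case by (auto intro: eventually_conj)
  next
    case (UN K)
    show ?case
    proof
      assume "l \<in> \<Union>K"
      then obtain k where k: "k \<in> K" "l \<in> k" by blast
      then have "eventually (\<lambda>n. f n \<in> k) F" using UN by blast
      then show "eventually (\<lambda>n. f n \<in> \<Union>K) F" by (rule eventually_mono) (use k in blast)
    qed
  qed (use * in auto)
  then show "limitin (topology_generated_by \<S>) f l F"
    unfolding limitin_def topology_generated_by_topspace
    using * openin_topology_generated_by by blast
qed

lemma limitin_local_J1_iff_restrict:
  fixes x :: "real \<Rightarrow> 'a::real_normed_vector"
  shows "limitin local_J1_topology X x F \<longleftrightarrow>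
     x \<in> cadlag_paths {0..} \<and> eventually (\<lambda>n. X n \<in> cadlag_paths {0..}) F \<and>
     (\<forall>T>0. limitin (J1_topology T) (\<lambda>n. restrict (X n) {0..T}) (restrict x {0..T}) F)"
  (is "?L \<longleftrightarrow> ?R")
proof
  assume L: ?L
  then have x: "x \<in> cadlag_paths {0..}" and X: "eventually (\<lambda>n. X n \<in> cadlag_paths {0..}) F"
    using openin_topspace[of "local_J1_topology :: (real \<Rightarrow> 'a) topology"]
    unfolding limitin_def topspace_local_J1 by blast+
  have "limitin (J1_topology T) (\<lambda>n. restrict (X n) {0..T}) (restrict x {0..T}) F" if T: "T > 0" for T
    unfolding limitin_def
  proof (intro conjI allI impI)
    show "restrict x {0..T} \<in> topspace (J1_topology T)"
      unfolding topspace_J1[OF less_imp_le[OF T]] by (rule cadlag_paths_restrict[OF x]) auto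
    fix U assume U: "openin (J1_topology T) U \<and> restrict x {0..T} \<in> U"
    then have "eventually (\<lambda>n. X n \<in> {x \<in> cadlag_paths {0..}. restrict x {0..T} \<in> U}) F"
      using T x
      by (intro L[unfolded local_J1_topology_def limitin_topology_generated_by,
            THEN conjunct2, rule_format]) auto
    then show "eventually (\<lambda>n. restrict (X n) {0..T} \<in> U) F" by (rule eventually_mono) auto
  qed
  then show ?R using x X by blast
next
  assume R: ?R
  have main: "eventually (\<lambda>n. X n \<in> {x \<in> cadlag_paths {0..}. restrict x {0..T} \<in> U}) F"
    if "T > 0" "openin (J1_topology T) U" "restrict x {0..T} \<in> U" for T U
  proof -
    have "eventually (\<lambda>n. restrict (X n) {0..T} \<in> U) F"
      using R that unfolding limitin_def by blast
    moreover have "eventually (\<lambda>n. X n \<in> cadlag_paths {0..}) F" using R by blast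
    ultimately show ?thesis by eventually_elim blast
  qed
  show ?L
    unfolding local_J1_topology_def limitin_topology_generated_by
  proof (intro conjI ballI impI)
    have "x \<in> topspace local_J1_topology" using R by (simp add: topspace_local_J1)
    then show "x \<in> \<Union>{{x \<in> cadlag_paths {0..}. restrict x {0..T} \<in> U} | T U.
        T > 0 \<and> openin (J1_topology T) U}"
      unfolding local_J1_topology_def topology_generated_by_topspace .
    fix V assume "V \<in> {{x \<in> cadlag_paths {0..}. restrict x {0..T} \<in> U} | T U.
        T > 0 \<and> openin (J1_topology T) U}" and xV: "x \<in> V"
    then obtain T U where V: "V = {x \<in> cadlag_paths {0..}. restrict x {0..T} \<in> U}"
      and TU: "T > 0" "openin (J1_topology T) U" by (elim CollectE exE conjE)
    have "restrict x {0..T} \<in> U" using xV V by simp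
    then show "eventually (\<lambda>n. X n \<in> V) F" unfolding V by (rule main[OF TU])
  qed
qed

lemma limitin_J1_sequentially:
  assumes T: "0 \<le> T" and X: "\<And>n. X n \<in> cadlag_paths {0..T}" and x: "x \<in> cadlag_paths {0..T}"
  shows "limitin (J1_topology T) X x sequentially \<longleftrightarrow>
    (\<exists>\<gamma>. (\<forall>n. \<gamma> n \<in> time_changes T) \<and> uniform_limit {0..T} \<gamma> (\<lambda>t. t) sequentially \<and>
         uniform_limit {0..T} (\<lambda>n t. X n (\<gamma> n t)) x sequentially)" (is "_ \<longleftrightarrow> ?R")
proof -
  have "limitin (J1_topology T) X x sequentially \<longleftrightarrow> (\<lambda>n. J1_dist T (X n) x) \<longlonglongrightarrow> 0"
    unfolding J1_topology_def Metric_space.limitin_metric_dist_null[OF Metric_space_J1[OF T]]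
    using X x by simp
  also have "\<dots> \<longleftrightarrow> ?R"
  proof
    assume lim: "(\<lambda>n. J1_dist T (X n) x) \<longlonglongrightarrow> 0"
    define b where "b n = J1_dist T (X n) x + inverse (real (Suc n))" for n
    have "b \<longlonglongrightarrow> 0 + 0" unfolding b_def
      by (intro tendsto_add lim LIMSEQ_inverse_real_of_nat)
    then have b: "\<forall>\<^sub>F n in sequentially. b n < e" if "e > 0" for e
      using that by (auto dest: order_tendstoD)
    have "\<exists>\<gamma>. \<gamma> \<in> time_changes T \<and> (\<forall>t\<in>{0..T}. \<bar>\<gamma> t - t\<bar> < b n \<and> norm (X n (\<gamma> t) - x t) < b n)" for n
    proof -
      have "J1_dist T (X n) x < b n" by (simp add: b_def)
      then show ?thesis using J1_dist_lessE[OF T X x] by metis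
    qed
    then obtain \<gamma> where lam: "\<And>n. \<gamma> n \<in> time_changes T"
      "\<And>n t. t \<in> {0..T} \<Longrightarrow> \<bar>\<gamma> n t - t\<bar> < b n" "\<And>n t. t \<in> {0..T} \<Longrightarrow> norm (X n (\<gamma> n t) - x t) < b n"
      by metis
    have "uniform_limit {0..T} \<gamma> (\<lambda>t. t) sequentially"
    proof (rule uniform_limitI)
      fix e :: real assume "0 < e"
      show "\<forall>\<^sub>F n in sequentially. \<forall>t\<in>{0..T}. dist (\<gamma> n t) t < e"
        using b[OF \<open>0 < e\<close>]
      proof eventually_elim
        case (elim n)
        then show ?case using lam(2)[of _ n] by (fastforce simp: dist_real_def)
      qed
    qed
    moreover have "uniform_limit {0..T} (\<lambda>n t. X n (\<gamma> n t)) x sequentially"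
    proof (rule uniform_limitI)
      fix e :: real assume "0 < e"
      show "\<forall>\<^sub>F n in sequentially. \<forall>t\<in>{0..T}. dist (X n (\<gamma> n t)) (x t) < e"
        using b[OF \<open>0 < e\<close>]
      proof eventually_elim
        case (elim n)
        then show ?case using lam(3)[of _ n] by (fastforce simp: dist_norm)
      qed
    qed
    ultimately show ?R using lam(1) by blast
  next
    assume ?R
    then obtain \<gamma> where lam: "\<And>n. \<gamma> n \<in> time_changes T" "uniform_limit {0..T} \<gamma> (\<lambda>t. t) sequentially"
      "uniform_limit {0..T} (\<lambda>n t. X n (\<gamma> n t)) x sequentially" by blast
    show "(\<lambda>n. J1_dist T (X n) x) \<longlonglongrightarrow> 0"
    proof (rule tendstoI)
      fix e :: real assume "e > 0"
      then have "e/2 > 0" by simp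
      have "\<forall>\<^sub>F n in sequentially. J1_dist T (X n) x \<le> e/2"
        using uniform_limitD[OF lam(2) \<open>e/2 > 0\<close>] uniform_limitD[OF lam(3) \<open>e/2 > 0\<close>]
      proof eventually_elim
        case (elim n)
        then show ?case
          by (intro J1_dist_le[OF T lam(1)[of n]]) (auto simp: dist_real_def dist_norm intro: less_imp_le)
      qed
      then show "\<forall>\<^sub>F n in sequentially. dist (J1_dist T (X n) x) 0 < e"
      proof (rule eventually_mono)
        fix n assume "J1_dist T (X n) x \<le> e/2"
        then show "dist (J1_dist T (X n) x) 0 < e"
          using \<open>e > 0\<close> Metric_space.nonneg[OF Metric_space_J1[OF T], of "X n" x]
          by (simp add: dist_real_def)
      qed
    qed
  qed
  finally show ?thesis .
qed

text \<open>
  The topological definition agrees with the usual sequential description of convergence.  Every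
  \<open>T > 0\<close> is required, including discontinuity points of the limit.
\<close>

theorem limitin_local_J1_sequentially:
  assumes X: "\<And>n. X n \<in> cadlag_paths {0..}" and x: "x \<in> cadlag_paths {0..}"
  shows "limitin local_J1_topology X x sequentially \<longleftrightarrow>
    (\<forall>T>0. \<exists>\<gamma>. (\<forall>n. \<gamma> n \<in> time_changes T) \<and> uniform_limit {0..T} \<gamma> (\<lambda>t. t) sequentially \<and>
         uniform_limit {0..T} (\<lambda>n t. X n (\<gamma> n t)) x sequentially)"
proof -
  have "limitin (J1_topology T) (\<lambda>n. restrict (X n) {0..T}) (restrict x {0..T}) sequentially \<longleftrightarrow>
     (\<exists>\<gamma>. (\<forall>n. \<gamma> n \<in> time_changes T) \<and> uniform_limit {0..T} \<gamma> (\<lambda>t. t) sequentially \<and>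
         uniform_limit {0..T} (\<lambda>n t. X n (\<gamma> n t)) x sequentially)" if T: "T > 0" for T
  proof -
    have sub: "{0..T} \<subseteq> {0..}" by auto
    have "uniform_limit {0..T} (\<lambda>n t. restrict (X n) {0..T} (\<gamma> n t)) (restrict x {0..T}) sequentially
        \<longleftrightarrow> uniform_limit {0..T} (\<lambda>n t. X n (\<gamma> n t)) x sequentially"
      if "\<forall>n. \<gamma> n \<in> time_changes T" for \<gamma>
      by (rule uniform_limit_cong') (use time_changes_mem[OF that[rule_format]] in auto)
    then show ?thesis
      using limitin_J1_sequentially[OF less_imp_le[OF T] cadlag_paths_restrict[OF X sub]
          cadlag_paths_restrict[OF x sub]] by meson
  qed
  then show ?thesis unfolding limitin_local_J1_iff_restrict using X x by simp
qed

end

theory Submission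
  imports Defs
begin

text \<open>
  On \<open>{0..T}\<close> the values \<open>(\<gamma>\<^sub>n t, x\<^sub>n (\<gamma>\<^sub>n t))\<close> eventually stay in one compact set, so
  the observables \<open>y\<^sub>n \<circ> \<gamma>\<^sub>n\<close> converge uniformly to \<open>y\<close>.  If \<open>y\<close> is bounded away from
  zero on \<open>{0..T}\<close>, surjectivity of \<open>\<gamma>\<^sub>n\<close> keeps \<open>y\<^sub>n\<close> negative on all of \<open>{0..T}\<close>, which gives
  the lower bound on \<open>\<tau>\<^sub>n\<close>.  For the upper bound, a time \<open>s\<close> shortly after \<open>\<tau>\<close> with \<open>y s > 0\<close>
  yields the exit times \<open>\<gamma>\<^sub>n s \<longlonglongrightarrow> s\<close> for \<open>y\<^sub>n\<close>.
\<close>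

lemma uniform_limit_observable:
  fixes x :: "real \<Rightarrow> 'a::{real_normed_vector, heine_borel}"
  assumes \<gamma>: "\<And>n. \<gamma> n \<in> time_changes T"
    and lim_\<gamma>: "uniform_limit {0..T} \<gamma> (\<lambda>t. t) sequentially"
    and lim_x: "uniform_limit {0..T} (\<lambda>n t. xs n (\<gamma> n t)) x sequentially"
    and bdd: "bounded (x ` {0..T})"
    and \<Phi>: "\<Phi> \<in> H_space"
    and lim_\<Phi>: "\<And>K. compact K \<Longrightarrow> K \<subseteq> {0..} \<times> UNIV \<Longrightarrow> uniform_limit K \<Phi>s \<Phi> sequentially"
  shows "uniform_limit {0..T} (\<lambda>n t. \<Phi>s n (\<gamma> n t, xs n (\<gamma> n t))) (\<lambda>t. \<Phi> (t, x t)) sequentially"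
proof (rule uniform_limitI)
  fix e :: real assume e: "e > 0"
  obtain R where R: "\<And>t. t \<in> {0..T} \<Longrightarrow> norm (x t) \<le> R"
    using bdd unfolding bounded_iff by blast
  \<comment> \<open>The path \<open>x\<close> stays in radius \<open>R\<close>; the extra 1 leaves
    room for \<open>xs n (\<gamma> n t)\<close>, so \<open>K\<close> does not depend on
    \<open>n\<close>.\<close>
  define K where "K = {0..T} \<times> cball (0::'a) (R + 1)"
  have K: "compact K" "K \<subseteq> {0..} \<times> UNIV"
    unfolding K_def by (auto intro: compact_Times)
  have "uniformly_continuous_on K \<Phi>"
    using \<Phi> K by (auto simp: H_space_def intro: compact_uniformly_continuous continuous_on_subset)
  then obtain d where d: "d > 0"
    "\<And>p q. p \<in> K \<Longrightarrow> q \<in> K \<Longrightarrow> dist q p < d \<Longrightarrow> dist (\<Phi> q) (\<Phi> p) < e/2"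
    unfolding uniformly_continuous_on_def using e by (metis half_gt_zero)
  \<comment> \<open>The bound 1 keeps the perturbed point in \<open>K\<close>; the bound
    \<open>d/2\<close> on each coordinate makes the distance in the product less than
    \<open>d\<close>.\<close>
  define d' where "d' = min 1 (d/2)"
  have d': "d' > 0" "d' \<le> 1" "d' \<le> d/2" using d by (auto simp: d'_def)
  show "\<forall>\<^sub>F n in sequentially. \<forall>t\<in>{0..T}.
      dist (\<Phi>s n (\<gamma> n t, xs n (\<gamma> n t))) (\<Phi> (t, x t)) < e"
    using uniform_limitD[OF lim_\<gamma> d'(1)] uniform_limitD[OF lim_x d'(1)]
      uniform_limitD[OF lim_\<Phi>[OF K] half_gt_zero[OF e]]
  proof eventually_elim
    case (elim n)
    show ?case
    proof
      fix t assume t: "t \<in> {0..T}"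
      let ?p = "(t, x t)" and ?q = "(\<gamma> n t, xs n (\<gamma> n t))"
      have dt: "dist (\<gamma> n t) t < d'" and dx: "dist (xs n (\<gamma> n t)) (x t) < d'"
        using elim t by auto
      have "norm (xs n (\<gamma> n t)) \<le> R + 1"
        using R[OF t] dx d'(2) norm_triangle_sub[of "xs n (\<gamma> n t)" "x t"]
        by (simp add: dist_norm)
      then have q: "?q \<in> K" using time_changes_mem[OF \<gamma> t] by (simp add: K_def)
      have p: "?p \<in> K" using t R[OF t] by (simp add: K_def)
      have "dist ?q ?p \<le> dist (\<gamma> n t) t + dist (xs n (\<gamma> n t)) (x t)"
        unfolding dist_Pair_Pair by (rule sqrt_sum_squares_le_sum) auto
      then have "dist ?q ?p < d" using dt dx d'(3) by linarith
      then have "dist (\<Phi> ?q) (\<Phi> ?p) < e/2" by (rule d(2)[OF p q])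
      moreover have "dist (\<Phi>s n ?q) (\<Phi> ?q) < e/2" using elim(3) q by blast
      ultimately show "dist (\<Phi>s n ?q) (\<Phi> ?p) < e"
        using dist_triangle[of "\<Phi>s n ?q" "\<Phi> ?p" "\<Phi> ?q"] by linarith
    qed
  qed
qed

lemma local_J1_observableE:
  fixes x :: "real \<Rightarrow> 'a::{real_normed_vector, heine_borel}"
  assumes xs: "\<And>n. xs n \<in> cadlag_paths {0..}" and x: "x \<in> cadlag_paths {0..}"
    and lim: "limitin local_J1_topology xs x sequentially"
    and \<Phi>: "\<Phi> \<in> H_space"
    and lim_\<Phi>: "\<And>K. compact K \<Longrightarrow> K \<subseteq> {0..} \<times> UNIV \<Longrightarrow> uniform_limit K \<Phi>s \<Phi> sequentially"
    and T: "T > 0"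
  obtains \<gamma> where "\<And>n. \<gamma> n \<in> time_changes T" "uniform_limit {0..T} \<gamma> (\<lambda>t. t) sequentially"
    "uniform_limit {0..T} (\<lambda>n t. \<Phi>s n (\<gamma> n t, xs n (\<gamma> n t))) (\<lambda>t. \<Phi> (t, x t)) sequentially"
proof -
  obtain \<gamma> where \<gamma>: "\<And>n. \<gamma> n \<in> time_changes T" "uniform_limit {0..T} \<gamma> (\<lambda>t. t) sequentially"
    "uniform_limit {0..T} (\<lambda>n t. xs n (\<gamma> n t)) x sequentially"
    using lim T unfolding limitin_local_J1_sequentially[OF xs x] by blast
  \<comment> \<open>Paths on \<open>{0..T}\<close> must be extensional, so boundedness is taken from
    the restriction, which has the same image.\<close>
  have "restrict x {0..T} \<in> cadlag_paths {0..T}"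
    by (rule cadlag_paths_restrict[OF x]) auto
  then have "bounded (x ` {0..T})"
    using cadlag_paths_bounded[of "restrict x {0..T}" T] by simp
  then show thesis
    using that[OF \<gamma>(1,2)] uniform_limit_observable[OF \<gamma> _ \<Phi> lim_\<Phi>] by blast
qed

lemma exit_time_nonneg: "0 \<le> exit_time x \<Phi>"
  unfolding exit_time_def by (auto intro: INF_greatest)

lemma exit_time_le: "0 \<le> t \<Longrightarrow> 0 \<le> \<Phi> (t, x t) \<Longrightarrow> exit_time x \<Phi> \<le> ereal t"
  unfolding exit_time_def by (auto intro: INF_lower)

lemma exit_time_ge:
  assumes "\<And>t. t \<in> {0..T} \<Longrightarrow> \<Phi> (t, x t) < 0"
  shows "ereal T \<le> exit_time x \<Phi>"
  unfolding exit_time_def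
proof (rule INF_greatest)
  fix t assume "t \<in> {t. 0 \<le> t \<and> 0 \<le> \<Phi> (t, x t)}"
  then show "ereal T \<le> ereal t" using assms[of t] by force
qed

text \<open>Both alternatives of \<open>NT\<close> give this bound, so the lower estimate needs no
  case split on whether the exit time is finite.\<close>

lemma NT_sup_neg:
  assumes "NT x \<Phi>" "T > 0" "ereal T < exit_time x \<Phi>"
  shows "(SUP s\<in>{0..T}. ereal (\<Phi> (s, x s))) < 0"
  using assms unfolding NT_def NT_no_exit_def NT_minus_def by blast

text \<open>A real number strictly between the supremum and 0 provides a uniform margin, which a
  uniformly small error cannot use up. This also works if the supremum is
  \<open>-\<infinity>\<close>.\<close>

lemma SUP_ereal_negE:
  assumes "(SUP s\<in>S. ereal (f s)) < 0"
  obtains c where "c > 0" "\<And>s. s \<in> S \<Longrightarrow> f s < - c"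
proof -
  obtain b where b: "(SUP s\<in>S. ereal (f s)) < ereal b" "ereal b < 0"
    using ereal_dense2[OF assms] by blast
  have "f s < b" if "s \<in> S" for s
    using le_less_trans[OF SUP_upper[OF that] b(1)] by simp
  then show thesis using b(2) by (intro that[of "- b"]) auto
qed

lemma NT_positive_after_exit:
  assumes "NT x \<Phi>" "exit_time x \<Phi> < a"
  obtains s where "0 \<le> s" "ereal s < a" "0 < \<Phi> (s, x s)"
proof -
  let ?\<tau> = "exit_time x \<Phi>"
  have fin: "?\<tau> < \<infinity>" using assms(2) by auto
  then obtain r where r: "?\<tau> = ereal r"
    using exit_time_nonneg[of x \<Phi>] by (cases ?\<tau>) auto
  have plus: "NT_plus x \<Phi>" using assms(1) fin unfolding NT_def NT_no_exit_def by auto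
  \<comment> \<open>Since \<open>a\<close> may be infinite, a real \<open>b\<close> below it fixes
    the window length \<open>b - r\<close> for \<open>NT_plus\<close>; the closed window then ends
    at \<open>b\<close>, strictly before \<open>a\<close>.\<close>
  obtain b where b: "?\<tau> < ereal b" "ereal b < a" using ereal_dense2[OF assms(2)] by blast
  then have "b - r > 0" using r by simp
  then have "0 < (SUP s\<in>{s. ?\<tau> \<le> ereal s \<and> ereal s \<le> ?\<tau> + ereal (b - r)}.
      ereal (\<Phi> (s, x s)))"
    using plus unfolding NT_plus_def by blast
  then obtain s where s: "?\<tau> \<le> ereal s" "ereal s \<le> ?\<tau> + ereal (b - r)" "0 < \<Phi> (s, x s)"
    unfolding less_SUP_iff by auto
  have "0 \<le> s" using order_trans[OF exit_time_nonneg s(1)] by simp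
  moreover have "ereal s \<le> ereal b" using s(2) r by simp
  then have "ereal s < a" using b(2) by (rule le_less_trans)
  ultimately show thesis using s(3) that by blast
qed

theorem theorem3p1:
  fixes x :: "real \<Rightarrow> real ^ 'd" and xs :: "nat \<Rightarrow> real \<Rightarrow> real ^ 'd"
    and \<Phi> :: "real \<times> (real ^ 'd) \<Rightarrow> real" and \<Phi>s :: "nat \<Rightarrow> real \<times> (real ^ 'd) \<Rightarrow> real"
  assumes "\<And>n. xs n \<in> cadlag_paths {0..}" and "x \<in> cadlag_paths {0..}"
    and "limitin local_J1_topology xs x sequentially"
    and "\<And>n. \<Phi>s n \<in> H_space" and "\<Phi> \<in> H_space"
    and "\<And>K. compact K \<Longrightarrow> K \<subseteq> {0..} \<times> UNIV \<Longrightarrow> uniform_limit K \<Phi>s \<Phi> sequentially"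
    and "NT x \<Phi>"
  shows "(\<lambda>n. exit_time (xs n) (\<Phi>s n)) \<longlonglongrightarrow> exit_time x \<Phi>"
proof (rule order_tendstoI)
  fix a assume a: "a < exit_time x \<Phi>"
  show "\<forall>\<^sub>F n in sequentially. a < exit_time (xs n) (\<Phi>s n)"
  proof (cases "a < 0")
    \<comment> \<open>This case covers exit time 0. In the other one the horizon \<open>T\<close> is
      positive, as local convergence requires.\<close>
    case True
    then show ?thesis using exit_time_nonneg less_le_trans by (blast intro: always_eventually)
  next
    case False
    \<comment> \<open>Negativity on \<open>{0..T}\<close> yields only a weak bound \<open>T\<close>
      on the exit times, so \<open>T\<close> is taken strictly above \<open>a\<close>.\<close>
    obtain T where T: "a < ereal T" "ereal T < exit_time x \<Phi>"
      using ereal_dense2[OF a] by blast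
    have "0 < ereal T" using False T(1) by (meson le_less_trans not_le)
    then have T0: "T > 0" by simp
    obtain c where c: "c > 0" "\<And>s. s \<in> {0..T} \<Longrightarrow> \<Phi> (s, x s) < - c"
      using SUP_ereal_negE[OF NT_sup_neg[OF assms(7) T0 T(2)]] by blast
    obtain \<gamma> where \<gamma>: "\<And>n. \<gamma> n \<in> time_changes T"
      and lim: "uniform_limit {0..T} (\<lambda>n t. \<Phi>s n (\<gamma> n t, xs n (\<gamma> n t))) (\<lambda>t. \<Phi> (t, x t)) sequentially"
      using local_J1_observableE[OF assms(1-3,5,6) T0] by blast
    show ?thesis
      using uniform_limitD[OF lim c(1)]
    proof eventually_elim
      case (elim n)
      have "\<Phi>s n (t, xs n t) < 0" if t: "t \<in> {0..T}" for t
      proof -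
        \<comment> \<open>The limit is known only along \<open>\<gamma> n\<close>, so the observable
          at \<open>t\<close> is compared with the limiting one at \<open>\<mu> t\<close>.\<close>
        obtain \<mu> where \<mu>: "\<mu> \<in> time_changes T" "\<gamma> n (\<mu> t) = t"
          using time_changes_inverse[OF \<gamma>[of n]] t by metis
        have m: "\<mu> t \<in> {0..T}" by (rule time_changes_mem[OF \<mu>(1) t])
        have "dist (\<Phi>s n (t, xs n t)) (\<Phi> (\<mu> t, x (\<mu> t))) < c"
          using bspec[OF elim m] \<mu>(2) by simp
        then show ?thesis using c(2)[OF m] by (simp add: dist_real_def)
      qed
      then have "ereal T \<le> exit_time (xs n) (\<Phi>s n)" by (rule exit_time_ge)
      then show ?case by (rule less_le_trans[OF T(1)])
    qed
  qed
next
  fix a assume "exit_time x \<Phi> < a"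
  then obtain s where s: "0 \<le> s" "ereal s < a" "0 < \<Phi> (s, x s)"
    using NT_positive_after_exit[OF assms(7)] by blast
  \<comment> \<open>The horizon may not be \<open>s\<close> itself, which can be \<open>0\<close>.\<close>
  have T0: "s + 1 > 0" and sT: "s \<in> {0..s + 1}" using s by auto
  obtain \<gamma> where \<gamma>: "\<And>n. \<gamma> n \<in> time_changes (s + 1)"
    and lim_\<gamma>: "uniform_limit {0..s + 1} \<gamma> (\<lambda>t. t) sequentially"
    and lim: "uniform_limit {0..s + 1} (\<lambda>n t. \<Phi>s n (\<gamma> n t, xs n (\<gamma> n t))) (\<lambda>t. \<Phi> (t, x t)) sequentially"
    using local_J1_observableE[OF assms(1-3,5,6) T0] by blast
  have "(\<lambda>n. ereal (\<gamma> n s)) \<longlonglongrightarrow> ereal s"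
    using tendsto_uniform_limitI[OF lim_\<gamma> sT] by simp
  then have "\<forall>\<^sub>F n in sequentially. ereal (\<gamma> n s) < a" by (rule order_tendstoD) (rule s(2))
  moreover have "\<forall>\<^sub>F n in sequentially. 0 < \<Phi>s n (\<gamma> n s, xs n (\<gamma> n s))"
    using tendsto_uniform_limitI[OF lim sT] s(3) by (rule order_tendstoD)
  ultimately show "\<forall>\<^sub>F n in sequentially. exit_time (xs n) (\<Phi>s n) < a"
  proof eventually_elim
    case (elim n)
    \<comment> \<open>Time changes preserve \<open>{0..s + 1}\<close>, so
      \<open>\<gamma> n s\<close> is nonnegative and belongs to the set whose infimum is the exit
      time.\<close>
    have "exit_time (xs n) (\<Phi>s n) \<le> ereal (\<gamma> n s)"
      using elim(2) time_changes_mem[OF \<gamma> sT] by (intro exit_time_le) auto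
    then show ?case using elim(1) by (rule le_less_trans)
  qed
qed

end
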